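(* Let $G$ be a simple mixed graph on $n$ vertices $v_1,\dots,v_n$, with integrated adjacency matrix $\mathcal{I}(G)$ whose rows and columns are indexed by $v'_1,\dots,v'_n,v''_1,\dots,v''_n$, and let $k$ be a positive integer. Then for all $i,j\in\{1,\dots,n\}$: (i) the $(v'_i,v'_j)$-th entry of $\mathcal{I}(G)^k$ is the sum of the number of walks in $G$ from $v_i$ to $v_j$ of length $k$ containing no arcs and the number of alternating walks in $G$ from $v_i$ to $v_j$ of length $k$ containing an even number of arcs with the first arc being directed in the forward direction; (ii) the $(v'_i,v''_j)$-th entry of $\mathcal{I}(G)^k$ is the number of alternating walks in $G$ from $v_i$ to $v_j$ of length $k$ containing an odd number of arcs with the first arc being directed in the forward direction; (iii) the $(v''_i,v'_j)$-th entry of $\mathcal{I}(G)^k$ is the number of alternating walks in $G$ from $v_i$ to $v_j$ of length $k$ containing an odd number of arcs with the first arc being directed in the backward direction; (iv) the $(v''_i,v''_j)$-th entry of $\mathcal{I}(G)^k$ is the sum of the number of walks in $G$ from $v_i$ to $v_j$ of length $k$ containing no arcs and the number of alternating walks in $G$ from $v_i$ to $v_j$ of length $k$ containing an even number of arcs with the first arc being directed in the backward direction.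
   Context: A mixed graph $G$ has a finite nonempty vertex set $V_G=\{v_1,\dots,v_n\}$, a finite set $E_G$ of (undirected) edges, each joining an unordered pair of vertices $\{u,v\}$ (a loop if $u=v$), and a finite set $\vec E_G$ of arcs, each going from $u$ to $v$ for an ordered pair $(u,v)$ of vertices (a directed loop if $u=v$); multiple edges, loops, arcs and directed loops are allowed. $G$ is simple if it has no loops, no directed loops, at most one edge joining any two vertices, and at most one arc from $u$ to $v$ for each ordered pair $(u,v)$ (an edge and arcs in both directions may coexist on the same pair of vertices). The integrated adjacency matrix $\mathcal{I}(G)$, with rows and columns indexed by $v'_1,\dots,v'_n,v''_1,\dots,v''_n$ in this order, is the real symmetric $2n\times 2n$ matrix $\begin{bmatrix}A&D\\ D^T&A\end{bmatrix}$, where $A_{ij}$ ($i\neq j$) is the number of edges joining $v_i$ and $v_j$, $A_{ii}$ is twice the number of loops at $v_i$, and $D_{ij}$ is the number of arcs from $v_i$ to $v_j$. A walk in $G$ is a sequence $u_1,e_1,u_2,e_2,\dots,e_{k},u_{k+1}$ of vertices $u_i$ and edges or arcs $e_j$, where each $e_j$ is either an edge joining $u_j$ and $u_{j+1}$, or an arc from $u_j$ to $u_{j+1}$ (traversed in the forward direction), or an arc from $u_{j+1}$ to $u_j$ (traversed in the backward direction). It is a walk from $u_1$ to $u_{k+1}$ of length $k$ (repeated edges or arcs are counted as many times as they appear). An alternating walk is a walk containing at least one arc in which, starting from the first arc, the successive arcs alternate between the forward and the backward direction (edges may occur anywhere in between). The number of arcs in a walk is counted with repetition. *)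

theory Defs
  imports "Jordan_Normal_Form.Matrix"
begin

record ('v, 'e, 'a) mixed_graph =
  verts :: "'v set"
  edges :: "'e set"
  arcs :: "'a set"
  ends :: "'e \<Rightarrow> 'v set"
  tail :: "'a \<Rightarrow> 'v"
  head :: "'a \<Rightarrow> 'v"

definition edges_joining :: "('v, 'e, 'a) mixed_graph \<Rightarrow> 'v \<Rightarrow> 'v \<Rightarrow> 'e set" where
  "edges_joining G u v = {e \<in> edges G. ends G e = {u, v}}"

definition arcs_from_to :: "('v, 'e, 'a) mixed_graph \<Rightarrow> 'v \<Rightarrow> 'v \<Rightarrow> 'a set" where
  "arcs_from_to G u v = {a \<in> arcs G. tail G a = u \<and> head G a = v}"

locale mixed_graph =
  fixes G :: "('v, 'e, 'a) mixed_graph"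
  assumes finite_verts: "finite (verts G)"
    and verts_nonempty: "verts G \<noteq> {}"
    and finite_edges: "finite (edges G)"
    and finite_arcs: "finite (arcs G)"
    and ends_wf: "e \<in> edges G \<Longrightarrow> \<exists>u \<in> verts G. \<exists>v \<in> verts G. ends G e = {u, v}"
    and tail_wf: "a \<in> arcs G \<Longrightarrow> tail G a \<in> verts G"
    and head_wf: "a \<in> arcs G \<Longrightarrow> head G a \<in> verts G"

locale simple_mixed_graph = mixed_graph +
  assumes no_loops: "u \<in> verts G \<Longrightarrow> edges_joining G u u = {}"
    and no_directed_loops: "u \<in> verts G \<Longrightarrow> arcs_from_to G u u = {}"
    and no_multiple_edges:
      "u \<in> verts G \<Longrightarrow> v \<in> verts G \<Longrightarrow> card (edges_joining G u v) \<le> 1"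
    and no_multiple_arcs:
      "u \<in> verts G \<Longrightarrow> v \<in> verts G \<Longrightarrow> card (arcs_from_to G u v) \<le> 1"

text \<open>
  The list \<open>vs\<close> is the enumeration of the vertices that fixes the order of rows and columns.
  With \<open>n = length vs\<close> and indices counted from 0, the row (column) of the integrated adjacency
  matrix labelled by the primed copy of \<open>vs ! i\<close> is number \<open>i\<close>, and the one labelled by its
  doubly primed copy is number \<open>n + i\<close>.
\<close>

definition edge_matrix :: "('v, 'e, 'a) mixed_graph \<Rightarrow> 'v list \<Rightarrow> real mat" where
  "edge_matrix G vs = mat (length vs) (length vs)
     (\<lambda>(i, j). if i = j then 2 * real (card (edges_joining G (vs ! i) (vs ! i)))
               else real (card (edges_joining G (vs ! i) (vs ! j))))"

definition arc_matrix :: "('v, 'e, 'a) mixed_graph \<Rightarrow> 'v list \<Rightarrow> real mat" where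
  "arc_matrix G vs = mat (length vs) (length vs)
     (\<lambda>(i, j). real (card (arcs_from_to G (vs ! i) (vs ! j))))"

definition integrated_adjacency_matrix ::
    "('v, 'e, 'a) mixed_graph \<Rightarrow> 'v list \<Rightarrow> real mat" where
  "integrated_adjacency_matrix G vs =
     four_block_mat (edge_matrix G vs) (arc_matrix G vs)
       (transpose_mat (arc_matrix G vs)) (edge_matrix G vs)"

datatype ('e, 'a) link = Edge 'e | is_Arc: Arc 'a

text \<open>
  A sequence \<open>u\<^sub>1, e\<^sub>1, \<dots>, e\<^sub>k, u\<^sub>k\<^sub>+\<^sub>1\<close> is represented by the pair of the list of the vertices
  \<open>u\<^sub>j\<close> and the list of the links \<open>e\<^sub>j\<close>.
\<close>

type_synonym ('v, 'e, 'a) vseq = "'v list \<times> ('e, 'a) link list"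

fun edge_step :: "('v, 'e, 'a) mixed_graph \<Rightarrow> 'v \<Rightarrow> ('e, 'a) link \<Rightarrow> 'v \<Rightarrow> bool" where
  "edge_step G u (Edge e) v \<longleftrightarrow> e \<in> edges_joining G u v"
| "edge_step G u (Arc a) v \<longleftrightarrow> False"

fun forward_step :: "('v, 'e, 'a) mixed_graph \<Rightarrow> 'v \<Rightarrow> ('e, 'a) link \<Rightarrow> 'v \<Rightarrow> bool" where
  "forward_step G u (Edge e) v \<longleftrightarrow> False"
| "forward_step G u (Arc a) v \<longleftrightarrow> a \<in> arcs_from_to G u v"

fun backward_step :: "('v, 'e, 'a) mixed_graph \<Rightarrow> 'v \<Rightarrow> ('e, 'a) link \<Rightarrow> 'v \<Rightarrow> bool" where
  "backward_step G u (Edge e) v \<longleftrightarrow> False"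
| "backward_step G u (Arc a) v \<longleftrightarrow> a \<in> arcs_from_to G v u"

definition forward_at :: "('v, 'e, 'a) mixed_graph \<Rightarrow> ('v, 'e, 'a) vseq \<Rightarrow> nat \<Rightarrow> bool" where
  "forward_at G w m \<longleftrightarrow> forward_step G (fst w ! m) (snd w ! m) (fst w ! Suc m)"

definition backward_at :: "('v, 'e, 'a) mixed_graph \<Rightarrow> ('v, 'e, 'a) vseq \<Rightarrow> nat \<Rightarrow> bool" where
  "backward_at G w m \<longleftrightarrow> backward_step G (fst w ! m) (snd w ! m) (fst w ! Suc m)"

definition walk :: "('v, 'e, 'a) mixed_graph \<Rightarrow> ('v, 'e, 'a) vseq \<Rightarrow> bool" where
  "walk G w \<longleftrightarrow>
     length (fst w) = Suc (length (snd w)) \<and> set (fst w) \<subseteq> verts G \<and>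
     (\<forall>m < length (snd w).
        edge_step G (fst w ! m) (snd w ! m) (fst w ! Suc m) \<or> forward_at G w m \<or> backward_at G w m)"

definition walks_from_to ::
    "('v, 'e, 'a) mixed_graph \<Rightarrow> 'v \<Rightarrow> 'v \<Rightarrow> nat \<Rightarrow> ('v, 'e, 'a) vseq set" where
  "walks_from_to G u v k =
     {w. walk G w \<and> hd (fst w) = u \<and> last (fst w) = v \<and> length (snd w) = k}"

definition arc_positions :: "('v, 'e, 'a) vseq \<Rightarrow> nat list" where
  "arc_positions w = filter (\<lambda>m. is_Arc (snd w ! m)) [0..<length (snd w)]"

definition num_arcs :: "('v, 'e, 'a) vseq \<Rightarrow> nat" where
  "num_arcs w = length (arc_positions w)"

text \<open>
  At a directed loop a walk counts as moving both forward and backward; in a graph without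
  directed loops the direction of every arc of a walk is unique.
\<close>

definition alternating_walk :: "('v, 'e, 'a) mixed_graph \<Rightarrow> ('v, 'e, 'a) vseq \<Rightarrow> bool" where
  "alternating_walk G w \<longleftrightarrow>
     walk G w \<and> num_arcs w \<ge> 1 \<and>
     ((\<forall>r < num_arcs w. if even r then forward_at G w (arc_positions w ! r)
                       else backward_at G w (arc_positions w ! r)) \<or>
      (\<forall>r < num_arcs w. if even r then backward_at G w (arc_positions w ! r)
                       else forward_at G w (arc_positions w ! r)))"

definition first_arc_forward :: "('v, 'e, 'a) mixed_graph \<Rightarrow> ('v, 'e, 'a) vseq \<Rightarrow> bool" where
  "first_arc_forward G w \<longleftrightarrow> num_arcs w \<ge> 1 \<and> forward_at G w (hd (arc_positions w))"

definition first_arc_backward :: "('v, 'e, 'a) mixed_graph \<Rightarrow> ('v, 'e, 'a) vseq \<Rightarrow> bool" where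
  "first_arc_backward G w \<longleftrightarrow> num_arcs w \<ge> 1 \<and> backward_at G w (hd (arc_positions w))"

end

theory Submission
  imports Defs
begin

text \<open>
  The proof reads the matrix as the adjacency matrix of a double cover of the graph.  A primed
  vertex stands for the state "the next arc has to be traversed forward" and a doubly primed one
  for the state "the next arc has to be traversed backward".  Along an edge the state is kept, along
  an arc it is flipped: this is exactly the block pattern with the edge matrix on the diagonal,
  the arc matrix leading from primed to doubly primed vertices, and its transpose leading back.
  Writing the states as Booleans (\<open>True\<close> for forward), the entry in row \<open>(b, i)\<close> and column
  \<open>(b', j)\<close> is thus the number of links allowed by the transition from \<open>b\<close> to \<open>b'\<close>
  (\<open>integrated_adjacency_matrix_entry\<close>).

  Powers of a matrix count the paths in the cover, and a path in the cover is a walk of the graph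
  together with its initial state such that the arcs alternate as prescribed by that state; the
  final state is the initial one exactly when the number of arcs is even.  The induction
  (\<open>card_state_walks\<close>) removes the first link of a walk (\<open>alternates_Cons\<close>), which leaves an
  alternating walk with one step less for the state reached.

  It remains to translate states into the words of the theorem.  A walk without arcs is
  alternating for both states, which is why such walks are counted in both diagonal blocks.
  For a walk with an arc, the initial state is the direction of its first arc; since there are no
  directed loops, that direction is unique (\<open>alternates_iff\<close>).
\<close>

section \<open>Walks that alternate from a given state\<close>

definition transition_links ::
    "('v, 'e, 'a) mixed_graph \<Rightarrow> bool \<Rightarrow> bool \<Rightarrow> 'v \<Rightarrow> 'v \<Rightarrow> ('e, 'a) link set" where
  "transition_links G b b' u x =
     {l. if b' = b then edge_step G u l x
         else if b then forward_step G u l x else backward_step G u l x}"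

definition alternates ::
    "('v, 'e, 'a) mixed_graph \<Rightarrow> bool \<Rightarrow> ('v, 'e, 'a) vseq \<Rightarrow> bool" where
  "alternates G b w \<longleftrightarrow> walk G w \<and>
     (\<forall>r < num_arcs w. if even r = b then forward_at G w (arc_positions w ! r)
                       else backward_at G w (arc_positions w ! r))"

text \<open>
  The walks that project from paths of length \<open>k\<close> in the double cover from the copy of \<open>u\<close> in
  state \<open>b\<close> to the copy of \<open>v\<close> in state \<open>c\<close>; the parity condition says that the final state is \<open>c\<close>.
\<close>

definition state_walks ::
    "('v, 'e, 'a) mixed_graph \<Rightarrow> bool \<Rightarrow> bool \<Rightarrow> 'v \<Rightarrow> 'v \<Rightarrow> nat \<Rightarrow> ('v, 'e, 'a) vseq set" where
  "state_walks G b c u v k =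
     {w \<in> walks_from_to G u v k. alternates G b w \<and> (even (num_arcs w) \<longleftrightarrow> c = b)}"

section \<open>Removing the first link of a walk\<close>

lemma arc_positions_Cons:
  "arc_positions (u # xs, l # ls) =
     (if is_Arc l then [0] else []) @ map Suc (arc_positions (xs, ls))"
proof -
  have "[0..<length (l # ls)] = 0 # map Suc [0..<length ls]"
    by (simp add: upt_conv_Cons map_Suc_upt del: upt_Suc)
  then show ?thesis
    by (simp add: arc_positions_def filter_map o_def del: upt_Suc)
qed

lemma num_arcs_Cons:
  "num_arcs (u # xs, l # ls) = (if is_Arc l then 1 else 0) + num_arcs (xs, ls)"
  by (simp add: num_arcs_def arc_positions_Cons)

lemma forward_at_Cons [simp]:
  "forward_at G (u # x # xs, l # ls) 0 = forward_step G u l x"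
  "forward_at G (u # xs, l # ls) (Suc m) = forward_at G (xs, ls) m"
  by (simp_all add: forward_at_def)

lemma backward_at_Cons [simp]:
  "backward_at G (u # x # xs, l # ls) 0 = backward_step G u l x"
  "backward_at G (u # xs, l # ls) (Suc m) = backward_at G (xs, ls) m"
  by (simp_all add: backward_at_def)

lemma walk_Cons:
  "walk G (u # x # xs, l # ls) \<longleftrightarrow>
     u \<in> verts G \<and> (edge_step G u l x \<or> forward_step G u l x \<or> backward_step G u l x) \<and>
     walk G (x # xs, ls)"
  unfolding walk_def by (auto simp: All_less_Suc2)

lemma alternates_Cons:
  "alternates G b (u # x # xs, l # ls) \<longleftrightarrow>
     u \<in> verts G \<and> (\<exists>b'. l \<in> transition_links G b b' u x \<and> alternates G b' (x # xs, ls))"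
proof (cases l)
  case (Edge e)
  then have "arc_positions (u # x # xs, l # ls) = map Suc (arc_positions (x # xs, ls))"
    and "num_arcs (u # x # xs, l # ls) = num_arcs (x # xs, ls)"
    by (simp_all add: arc_positions_Cons num_arcs_Cons)
  with Edge show ?thesis
    by (auto simp: alternates_def walk_Cons transition_links_def num_arcs_def split: if_splits)
next
  case (Arc a)
  then have "arc_positions (u # x # xs, l # ls) = 0 # map Suc (arc_positions (x # xs, ls))"
    and "num_arcs (u # x # xs, l # ls) = Suc (num_arcs (x # xs, ls))"
    by (simp_all add: arc_positions_Cons num_arcs_Cons)
  then show ?thesis
    by (cases b) (auto simp: Arc alternates_def walk_Cons transition_links_def num_arcs_def All_less_Suc2
        split: if_splits)
qed

text \<open>
  A change of state happens exactly at an arc, so the parity condition carries over from the walk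
  to its remainder.
\<close>

lemma even_num_arcs_Cons:
  assumes "l \<in> transition_links G b b' u x"
  shows "(even (num_arcs (u # xs, l # ls)) \<longleftrightarrow> c = b) \<longleftrightarrow> (even (num_arcs (xs, ls)) \<longleftrightarrow> c = b')"
  using assms by (cases l; cases b; cases b'; cases c)
    (auto simp: num_arcs_Cons transition_links_def)

lemma state_walks_Cons:
  "(u' # x # xs, l # ls) \<in> state_walks G b c u v (Suc k) \<longleftrightarrow>
     u' = u \<and> u \<in> verts G \<and>
     (\<exists>b'. l \<in> transition_links G b b' u x \<and> (x # xs, ls) \<in> state_walks G b' c x v k)"
proof -
  have walk: "walk G w" if "alternates G d w" for d w
    using that by (simp add: alternates_def)
  have "(u' # x # xs, l # ls) \<in> state_walks G b c u v (Suc k) \<longleftrightarrow>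
      u' = u \<and> last (x # xs) = v \<and> length ls = k \<and> alternates G b (u # x # xs, l # ls) \<and>
      (even (num_arcs (u # x # xs, l # ls)) \<longleftrightarrow> c = b)"
    using walk by (auto simp: state_walks_def walks_from_to_def)
  also have "\<dots> \<longleftrightarrow> u' = u \<and> u \<in> verts G \<and>
      (\<exists>b'. l \<in> transition_links G b b' u x \<and> last (x # xs) = v \<and> length ls = k \<and>
        alternates G b' (x # xs, ls) \<and> (even (num_arcs (x # xs, ls)) \<longleftrightarrow> c = b'))"
    unfolding alternates_Cons using even_num_arcs_Cons by metis
  also have "\<dots> \<longleftrightarrow> u' = u \<and> u \<in> verts G \<and>
      (\<exists>b'. l \<in> transition_links G b b' u x \<and> (x # xs, ls) \<in> state_walks G b' c x v k)"
    using walk by (auto simp: state_walks_def walks_from_to_def)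
  finally show ?thesis .
qed

lemma state_walks_ConsE:
  assumes "(ys, ls) \<in> state_walks G b c x v k"
  obtains xs where "ys = x # xs" "x \<in> verts G"
  using assms by (cases ys) (auto simp: state_walks_def walks_from_to_def walk_def)

lemma state_walks_0:
  assumes "u \<in> verts G"
  shows "state_walks G b c u v 0 = (if u = v \<and> b = c then {([u], [])} else {})"
  using assms
  by (auto simp: state_walks_def walks_from_to_def walk_def alternates_def num_arcs_def
      arc_positions_def length_Suc_conv)

text \<open>
  The state after the first step is determined by the link, whence the decomposition of a walk into
  its first link, the state reached and the remaining walk is unique.
\<close>

lemma bij_betw_state_walks_Suc:
  assumes "u \<in> verts G"
  shows "bij_betw (\<lambda>((x, b'), (l, w)). (u # fst w, l # snd w))
     (SIGMA (x, b') : verts G \<times> UNIV. transition_links G b b' u x \<times> state_walks G b' c x v k)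
     (state_walks G b c u v (Suc k))"
    (is "bij_betw ?f ?S ?T")
proof (rule bij_betw_imageI)
  have link: "b1 = b2" if "l \<in> transition_links G b b1 u x" "l \<in> transition_links G b b2 u x" for l b1 b2 x
    using that by (cases l) (auto simp: transition_links_def split: if_splits)
  show "inj_on ?f ?S"
  proof (rule inj_onI; clarsimp)
    fix x1 b1 l xs ls x2 b2
    assume w: "(xs, ls) \<in> state_walks G b1 c x1 v k" "(xs, ls) \<in> state_walks G b2 c x2 v k"
      and l: "l \<in> transition_links G b b1 u x1" "l \<in> transition_links G b b2 u x2"
    from w have "x1 = x2"
      by (auto elim!: state_walks_ConsE)
    with l show "x1 = x2 \<and> b1 = b2"
      using link by auto
  qed
  show "?f ` ?S = ?T"
  proof (intro equalityI subsetI)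
    fix w assume "w \<in> ?f ` ?S"
    then obtain x b' l ys ls where w_eq: "w = (u # ys, l # ls)"
      and l: "l \<in> transition_links G b b' u x" and rest: "(ys, ls) \<in> state_walks G b' c x v k"
      by auto
    from rest obtain xs where "ys = x # xs"
      by (rule state_walks_ConsE)
    with assms l rest show "w \<in> ?T"
      unfolding w_eq by (auto simp: state_walks_Cons)
  next
    fix w assume w: "w \<in> ?T"
    then have "length (fst w) = Suc (Suc k)" "length (snd w) = Suc k"
      by (auto simp: state_walks_def walks_from_to_def walk_def)
    then obtain u' x xs l ls where w_eq: "w = (u' # x # xs, l # ls)"
      by (cases w) (auto simp: length_Suc_conv)
    from w obtain b' where "u' = u" "l \<in> transition_links G b b' u x"
      and rest: "(x # xs, ls) \<in> state_walks G b' c x v k"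
      unfolding w_eq state_walks_Cons by blast
    moreover from rest have "x \<in> verts G"
      by (auto elim: state_walks_ConsE)
    ultimately show "w \<in> ?f ` ?S"
      unfolding w_eq by (intro image_eqI[of _ _ "((x, b'), (l, (x # xs, ls)))"]) auto
  qed
qed

section \<open>Matrix powers count alternating walks\<close>

lemma transition_links_eq:
  "transition_links G b b u x = Edge ` edges_joining G u x"
  "transition_links G True False u x = Arc ` arcs_from_to G u x"
  "transition_links G False True u x = Arc ` arcs_from_to G x u"
  unfolding transition_links_def
  by (auto simp: image_iff elim: edge_step.elims forward_step.elims backward_step.elims)

lemma card_transition_links:
  "card (transition_links G b b u x) = card (edges_joining G u x)"
  "card (transition_links G True False u x) = card (arcs_from_to G u x)"
  "card (transition_links G False True u x) = card (arcs_from_to G x u)"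
  unfolding transition_links_eq by (simp_all add: card_image inj_on_def)

lemma (in mixed_graph) finite_transition_links: "finite (transition_links G b b' u x)"
proof -
  have "finite (edges_joining G u x)" "finite (arcs_from_to G y z)" for y z
    using finite_edges finite_arcs by (auto simp: edges_joining_def arcs_from_to_def)
  then show ?thesis
    by (cases b; cases b') (simp_all add: transition_links_eq)
qed

lemma (in mixed_graph) finite_state_walks:
  assumes "u \<in> verts G"
  shows "finite (state_walks G b c u v k)"
  using assms
proof (induction k arbitrary: b u)
  case 0
  then show ?case by (simp add: state_walks_0)
next
  case (Suc k)
  have "finite (SIGMA (x, b') : verts G \<times> UNIV. transition_links G b b' u x \<times> state_walks G b' c x v k)"
    using Suc.IH finite_verts finite_transition_links by (intro finite_SigmaI) auto
  then show ?case
    using bij_betw_finite[OF bij_betw_state_walks_Suc[OF Suc.prems]] by simp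
qed

lemma pow_mat_Suc_left:
  assumes "A \<in> carrier_mat n n"
  shows "A ^\<^sub>m Suc k = A * A ^\<^sub>m k"
proof (induction k)
  case 0
  then show ?case using assms by simp
next
  case (Suc k)
  then show ?case
    using assoc_mult_mat[OF assms pow_carrier_mat[OF assms] assms, of k] by simp
qed

definition state_index :: "nat \<Rightarrow> bool \<Rightarrow> nat \<Rightarrow> nat" where
  "state_index n b i = (if b then i else n + i)"

lemma integrated_adjacency_matrix_carrier:
  "integrated_adjacency_matrix G vs \<in> carrier_mat (length vs + length vs) (length vs + length vs)"
  by (simp add: integrated_adjacency_matrix_def edge_matrix_def arc_matrix_def)

text \<open>
  Without loops the factor two on the diagonal of the edge matrix multiplies zero, and every entry
  is a number of links.
\<close>

lemma (in simple_mixed_graph) integrated_adjacency_matrix_entry: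
  assumes "set vs = verts G" "i < length vs" "j < length vs"
  shows "integrated_adjacency_matrix G vs $$
      (state_index (length vs) b i, state_index (length vs) b' j) =
    real (card (transition_links G b b' (vs ! i) (vs ! j)))"
proof -
  have "edges_joining G (vs ! i) (vs ! i) = {}"
    using assms no_loops nth_mem by blast
  then show ?thesis
    using assms(2,3)
    by (cases b; cases b')
      (auto simp: integrated_adjacency_matrix_def edge_matrix_def arc_matrix_def
        state_index_def card_transition_links)
qed

lemma sum_state_index:
  fixes f :: "nat \<Rightarrow> real"
  shows "sum f {0..<n + n} = (\<Sum>i<n. \<Sum>b\<in>UNIV. f (state_index n b i))"
proof -
  have "sum f {0..<n + n} = sum f {0..<n} + sum f {n..<n + n}"
    by (simp add: sum.atLeastLessThan_concat)
  also have "sum f {n..<n + n} = (\<Sum>i<n. f (n + i))"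
    using sum.shift_bounds_nat_ivl[of f 0 n n] by (simp add: add.commute atLeast0LessThan)
  finally show ?thesis
    by (simp add: UNIV_bool state_index_def sum.distrib atLeast0LessThan add.commute)
qed

text \<open>
  The first factor of \<open>I * I ^ k\<close> accounts for the first link of a walk and the second factor for
  the walk that remains; summing over the inner index is summing over the vertex and the state
  reached by that link.
\<close>

lemma (in simple_mixed_graph) card_state_walks:
  assumes "distinct vs" "set vs = verts G" "i < length vs" "j < length vs"
  shows "(integrated_adjacency_matrix G vs ^\<^sub>m k) $$
      (state_index (length vs) b i, state_index (length vs) c j) =
    real (card (state_walks G b c (vs ! i) (vs ! j) k))"
  using assms(3)
proof (induction k arbitrary: b i)
  case 0
  then have "state_walks G b c (vs ! i) (vs ! j) 0 =
      (if i = j \<and> b = c then {([vs ! i], [])} else {})"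
    using assms nth_mem[of i vs] by (simp add: state_walks_0 nth_eq_iff_index_eq)
  with 0 show ?case
    using assms(4) integrated_adjacency_matrix_carrier[of G vs]
    by (auto simp: state_index_def)
next
  case (Suc k)
  define I n where "I = integrated_adjacency_matrix G vs" and "n = length vs"
  have I: "I \<in> carrier_mat (n + n) (n + n)"
    unfolding I_def n_def by (rule integrated_adjacency_matrix_carrier)
  then have pow: "I ^\<^sub>m k \<in> carrier_mat (n + n) (n + n)"
    by (rule pow_carrier_mat)
  have index: "state_index n d m < n + n" if "m < n" for d m
    using that by (simp add: state_index_def)
  have u: "vs ! i \<in> verts G"
    using Suc.prems assms(2) nth_mem by blast
  have "(I ^\<^sub>m Suc k) $$ (state_index n b i, state_index n c j) =
      (I * I ^\<^sub>m k) $$ (state_index n b i, state_index n c j)"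
    using pow_mat_Suc_left[OF I] by simp
  also have "\<dots> = (\<Sum>q = 0..<n + n. I $$ (state_index n b i, q) * (I ^\<^sub>m k) $$ (q, state_index n c j))"
    using I pow index Suc.prems assms(4)
    by (auto simp: times_mat_def scalar_prod_def n_def)
  also have "\<dots> = (\<Sum>m<n. \<Sum>b'\<in>UNIV. I $$ (state_index n b i, state_index n b' m) *
      (I ^\<^sub>m k) $$ (state_index n b' m, state_index n c j))"
    by (rule sum_state_index)
  also have "\<dots> = (\<Sum>m<n. \<Sum>b'\<in>UNIV. real (card (transition_links G b b' (vs ! i) (vs ! m)) *
      card (state_walks G b' c (vs ! m) (vs ! j) k)))"
    using Suc integrated_adjacency_matrix_entry[OF assms(2)]
    by (intro sum.cong refl) (simp add: I_def n_def)
  also have "\<dots> = (\<Sum>x\<in>verts G. \<Sum>b'\<in>UNIV. real (card (transition_links G b b' (vs ! i) x) *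
      card (state_walks G b' c x (vs ! j) k)))"
    using bij_betw_nth[OF assms(1)] assms(2)
    by (intro sum.reindex_bij_betw) (simp add: n_def)
  also have "\<dots> = real (\<Sum>(x, b')\<in>verts G \<times> UNIV. card (transition_links G b b' (vs ! i) x \<times>
      state_walks G b' c x (vs ! j) k))"
    by (simp add: sum.cartesian_product card_cartesian_product case_prod_unfold)
  also have "\<dots> = real (card (SIGMA (x, b') : verts G \<times> UNIV. transition_links G b b' (vs ! i) x \<times>
      state_walks G b' c x (vs ! j) k))"
    using finite_verts finite_transition_links finite_state_walks
    by (subst card_SigmaI) (auto simp: case_prod_unfold)
  also have "\<dots> = real (card (state_walks G b c (vs ! i) (vs ! j) (Suc k)))"
    using bij_betw_same_card[OF bij_betw_state_walks_Suc[OF u]] by simp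
  finally show ?case
    by (simp only: I_def n_def)
qed

section \<open>The initial state is the direction of the first arc\<close>

text \<open>
  An arc that leads from \<open>x\<close> to \<open>y\<close> and also from \<open>y\<close> to \<open>x\<close> has \<open>x = y\<close>, so it is a directed loop.
\<close>

lemma (in simple_mixed_graph) not_forward_and_backward:
  assumes "forward_at G w m" "backward_at G w m"
  shows False
proof -
  obtain a where link: "snd w ! m = Arc a"
    using assms(1) by (cases "snd w ! m") (simp_all add: forward_at_def)
  have "a \<in> arcs_from_to G (fst w ! m) (fst w ! Suc m)"
    and "a \<in> arcs_from_to G (fst w ! Suc m) (fst w ! m)"
    using assms unfolding forward_at_def backward_at_def link by simp_all
  then have "a \<in> arcs G" and "head G a = tail G a"
    unfolding arcs_from_to_def by (blast, metis (mono_tags, lifting) mem_Collect_eq)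
  then have "a \<in> arcs_from_to G (tail G a) (tail G a)" and "tail G a \<in> verts G"
    unfolding arcs_from_to_def using tail_wf by simp_all
  then show False
    using no_directed_loops by blast
qed

lemma hd_arc_positions: "num_arcs w \<ge> 1 \<Longrightarrow> hd (arc_positions w) = arc_positions w ! 0"
  by (cases "arc_positions w") (simp_all add: num_arcs_def)

lemma (in simple_mixed_graph) alternates_iff:
  "alternates G b w \<longleftrightarrow> walk G w \<and>
     (num_arcs w = 0 \<or>
      alternating_walk G w \<and> (if b then first_arc_forward G w else first_arc_backward G w))"
proof (cases "num_arcs w = 0")
  case True
  then show ?thesis by (simp add: alternates_def)
next
  case False
  then have pos: "num_arcs w \<ge> 1" by simp
  \<comment> \<open>The position of the first arc has index zero, which is even, and its direction decides
    which of the two alternating patterns the walk follows.\<close>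
  have alt: "alternating_walk G w \<longleftrightarrow> alternates G True w \<or> alternates G False w"
  proof -
    have flip: "(if even r = False then p else q) \<longleftrightarrow> (if even r then q else p)" for r :: nat and p q
      by simp
    show ?thesis
      unfolding alternating_walk_def alternates_def flip eq_True using pos by argo
  qed
  have dir: "if d then first_arc_forward G w else first_arc_backward G w"
    if "alternates G d w" for d
  proof -
    have "0 < num_arcs w \<longrightarrow> (if even (0::nat) = d then forward_at G w (arc_positions w ! 0)
        else backward_at G w (arc_positions w ! 0))"
      using that unfolding alternates_def by (elim conjE) (erule spec)
    with pos show ?thesis
      by (cases d)
        (simp_all add: first_arc_forward_def first_arc_backward_def hd_arc_positions[OF pos])
  qed
  have unique: "\<not> (first_arc_forward G w \<and> first_arc_backward G w)"
    using not_forward_and_backward unfolding first_arc_forward_def first_arc_backward_def by blast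
  have walk: "alternates G d w \<Longrightarrow> walk G w" for d
    by (simp add: alternates_def)
  show ?thesis
  proof
    assume b: "alternates G b w"
    then have "alternating_walk G w"
      unfolding alt by (cases b) simp_all
    with dir[OF b] walk[OF b]
    show "walk G w \<and> (num_arcs w = 0 \<or>
        alternating_walk G w \<and> (if b then first_arc_forward G w else first_arc_backward G w))"
      by iprover
  next
    assume "walk G w \<and> (num_arcs w = 0 \<or>
        alternating_walk G w \<and> (if b then first_arc_forward G w else first_arc_backward G w))"
    with False have "alternating_walk G w"
      and b: "if b then first_arc_forward G w else first_arc_backward G w"
      by iprover+
    then obtain d where d: "alternates G d w"
      unfolding alt by iprover
    from dir[OF d] b unique have "d = b"
      by (cases b; cases d) simp_all
    with d show "alternates G b w"
      by simp
  qed
qed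

lemma (in simple_mixed_graph) card_state_walks_same_state:
  assumes "u \<in> verts G"
  shows "card (state_walks G b b u v k) =
    card {w \<in> walks_from_to G u v k. num_arcs w = 0} +
    card {w \<in> walks_from_to G u v k. alternating_walk G w \<and> even (num_arcs w) \<and>
            (if b then first_arc_forward G w else first_arc_backward G w)}"
    (is "_ = card ?A + card ?B")
proof -
  have eq: "state_walks G b b u v k = ?A \<union> ?B"
    unfolding state_walks_def alternates_iff by (cases b) (auto simp: walks_from_to_def)
  have "num_arcs w \<noteq> 0" if "alternating_walk G w" for w
    using that unfolding alternating_walk_def by linarith
  then have disjoint: "?A \<inter> ?B = {}"
    by blast
  have "finite (?A \<union> ?B)"
    using finite_state_walks[OF assms] unfolding eq[symmetric] .
  then have "finite ?A" "finite ?B"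
    unfolding finite_Un by simp_all
  then show ?thesis
    unfolding eq using disjoint by (rule card_Un_disjoint)
qed

lemma (in simple_mixed_graph) state_walks_other_state:
  "state_walks G b (\<not> b) u v k =
     {w \<in> walks_from_to G u v k. alternating_walk G w \<and> odd (num_arcs w) \<and>
        (if b then first_arc_forward G w else first_arc_backward G w)}"
  unfolding state_walks_def alternates_iff by (cases b) (auto simp: walks_from_to_def)

theorem theorem4p4:
  fixes G :: "('v, 'e, 'a) mixed_graph" and vs :: "'v list" and n k i j :: nat
  assumes "simple_mixed_graph G"
    and "distinct vs" and "set vs = verts G" and "length vs = n"
    and "k > 0"
    and "i < n" and "j < n"
  shows "(integrated_adjacency_matrix G vs ^\<^sub>m k) $$ (i, j) =
      real (card {w \<in> walks_from_to G (vs ! i) (vs ! j) k. num_arcs w = 0}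
        + card {w \<in> walks_from_to G (vs ! i) (vs ! j) k.
                 alternating_walk G w \<and> even (num_arcs w) \<and> first_arc_forward G w}) \<and>
    (integrated_adjacency_matrix G vs ^\<^sub>m k) $$ (i, n + j) =
      real (card {w \<in> walks_from_to G (vs ! i) (vs ! j) k.
                 alternating_walk G w \<and> odd (num_arcs w) \<and> first_arc_forward G w}) \<and>
    (integrated_adjacency_matrix G vs ^\<^sub>m k) $$ (n + i, j) =
      real (card {w \<in> walks_from_to G (vs ! i) (vs ! j) k.
                 alternating_walk G w \<and> odd (num_arcs w) \<and> first_arc_backward G w}) \<and>
    (integrated_adjacency_matrix G vs ^\<^sub>m k) $$ (n + i, n + j) =
      real (card {w \<in> walks_from_to G (vs ! i) (vs ! j) k. num_arcs w = 0}
        + card {w \<in> walks_from_to G (vs ! i) (vs ! j) k.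
                 alternating_walk G w \<and> even (num_arcs w) \<and> first_arc_backward G w})"
proof -
  interpret simple_mixed_graph G by fact
  have u: "vs ! i \<in> verts G"
    using assms(3,4,6) nth_mem by blast
  have entry: "(integrated_adjacency_matrix G vs ^\<^sub>m k) $$ (state_index n b i, state_index n c j) =
      real (card (state_walks G b c (vs ! i) (vs ! j) k))" for b c
    using card_state_walks[OF assms(2,3), of i j] assms(4,6,7) by simp
  \<comment> \<open>The target state is written as a negation to have the shape of the off-diagonal count.\<close>
  show ?thesis
    using entry[of True True, unfolded card_state_walks_same_state[OF u]]
      entry[of True "\<not> True", unfolded state_walks_other_state]
      entry[of False "\<not> False", unfolded state_walks_other_state]
      entry[of False False, unfolded card_state_walks_same_state[OF u]]
    unfolding state_index_def by (simp only: simp_thms if_True if_False)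
qed

end
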